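(* If $\alpha>0$, then for each $N\ge 2$ the Fleming-Viot process with $N$ particles is ergodic, that is, there exists a unique stationary probability measure for the process and, starting from any initial measure, the law of the process at time $t$ converges to this stationary measure as $t\to\infty$.
   Context: Let $\Lambda$ be a countable set, $0\notin\Lambda$, and let $(Z_t)_{t\ge 0}$ be a pure jump regular (non-explosive) continuous-time Markov process on $\Lambda\cup\{0\}$ with transition rates matrix $Q=(q(x,y))$ and transition probabilities $P_t(x,y)$, with $0$ absorbing: $q(0,x)=0$ for all $x\in\Lambda$. Standing assumptions: $\bar q:=\sup_{x\in\Lambda}\sum_{y\in(\Lambda\cup\{0\})\setminus\{x\}}q(x,y)<\infty$; $P_t(x,y)>0$ for all $x,y\in\Lambda$ and $t>0$; the absorption time at $0$ is almost surely finite for every initial state. Ergodicity coefficient: $\alpha:=\sum_{z\in\Lambda}\inf_{x\in\Lambda\setminus\{z\}}q(x,z)$ (with $\inf\emptyset=+\infty$). Fleming-Viot process with $N\ge 2$ particles: the continuous-time Markov process $\xi_t=(\xi_t(1),\dots,\xi_t(N))$ on $\Lambda^{\{1,\dots,N\}}$ in which particles move independently with rates $Q$ until absorption, and a particle that is absorbed at $0$ instantaneously jumps to the position of one of the other $N-1$ particles chosen uniformly at random. Its generator is $$\mathcal L^N f(\xi)=\sum_{i=1}^N\ \sum_{y\in\Lambda\setminus\{\xi(i)\}}\Bigl[q(\xi(i),y)+q(\xi(i),0)\,\frac{\eta(\xi,y)}{N-1}\Bigr]\bigl(f(\xi^{i,y})-f(\xi)\bigr),$$ where $\xi^{i,y}(j)=y$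 for $j=i$ and $\xi^{i,y}(j)=\xi(j)$ otherwise, and $\eta(\xi,y)=\sum_{i=1}^N\mathbf 1\{\xi(i)=y\}$. *)

theory Defs
  imports "HOL-Probability.Probability"
begin

text \<open>
  A process on the countable set \<open>S\<close> is given as a Markov family: random variables
  \<open>X t\<close>, \<open>t \<ge> 0\<close>, on a common sample space together with the law \<open>PP x\<close> of the process started
  from \<open>x\<close>, for each \<open>x \<in> S\<close>.
\<close>

definition trans_prob :: "('s \<Rightarrow> 'w measure) \<Rightarrow> (real \<Rightarrow> 'w \<Rightarrow> 's) \<Rightarrow> real \<Rightarrow> 's \<Rightarrow> 's \<Rightarrow> real" where
  "trans_prob PP X t x y = \<P>(\<omega> in PP x. X t \<omega> = y)"

text \<open>
  Regularity (non-explosion) is the requirement that the partition times \<open>\<tau> n\<close> tend to infinity.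
  The \<open>\<tau> n\<close> include all jump times, but the path need not jump at each of them, so that paths
  with only finitely many jumps (such as absorbed ones) are covered.
\<close>

definition regular_jump_path :: "(real \<Rightarrow> 's) \<Rightarrow> bool" where
  "regular_jump_path p \<longleftrightarrow>
     (\<exists>\<tau> :: nat \<Rightarrow> real. \<tau> 0 = 0 \<and> strict_mono \<tau> \<and> filterlim \<tau> at_top sequentially \<and>
        (\<forall>n. \<forall>t \<in> {\<tau> n ..< \<tau> (Suc n)}. p t = p (\<tau> n)))"

definition jump_markov_process ::
  "'s set \<Rightarrow> ('s \<Rightarrow> 'w measure) \<Rightarrow> (real \<Rightarrow> 'w \<Rightarrow> 's) \<Rightarrow> bool" where
  "jump_markov_process S PP X \<longleftrightarrow>
     (\<forall>x\<in>S.
        prob_space (PP x) \<and>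
        (\<forall>t\<ge>0. X t \<in> measurable (PP x) (count_space S)) \<and>
        (AE \<omega> in PP x. X 0 \<omega> = x) \<and>
        (AE \<omega> in PP x. regular_jump_path (\<lambda>t. X t \<omega>)) \<and>
        (\<forall>(n :: nat) (u :: nat \<Rightarrow> real) (a :: nat \<Rightarrow> 's).
           0 \<le> u 0 \<longrightarrow> mono u \<longrightarrow> (\<forall>i. a i \<in> S) \<longrightarrow>
           \<P>(\<omega> in PP x. \<forall>i\<le>Suc n. X (u i) \<omega> = a i) =
             \<P>(\<omega> in PP x. \<forall>i\<le>n. X (u i) \<omega> = a i) *
               trans_prob PP X (u (Suc n) - u n) (a n) (a (Suc n))))"

text \<open>The transition rates are the right derivatives at \<open>0\<close> of the transition probabilities; the
  matrix is conservative, that is, \<open>q x x = - (\<Sum>y \<noteq> x. q x y)\<close>.\<close>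

definition has_rates ::
  "'s set \<Rightarrow> ('s \<Rightarrow> 'w measure) \<Rightarrow> (real \<Rightarrow> 'w \<Rightarrow> 's) \<Rightarrow> ('s \<Rightarrow> 's \<Rightarrow> real) \<Rightarrow> bool" where
  "has_rates S PP X q \<longleftrightarrow>
     (\<forall>x\<in>S.
        (\<forall>y\<in>S - {x}. 0 \<le> q x y) \<and>
        (q x has_sum - q x x) (S - {x}) \<and>
        (\<forall>y\<in>S. ((\<lambda>t. (trans_prob PP X t x y - of_bool (x = y)) / t) \<longlongrightarrow> q x y) (at_right 0)))"

text \<open>The generator equation is required pointwise, for all bounded functions. When the jump rates are
  bounded, this determines the transition probabilities.\<close>

definition has_generator ::
  "'s set \<Rightarrow> ('s \<Rightarrow> 'w measure) \<Rightarrow> (real \<Rightarrow> 'w \<Rightarrow> 's) \<Rightarrow> (('s \<Rightarrow> real) \<Rightarrow> 's \<Rightarrow> real) \<Rightarrow> bool" where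
  "has_generator S PP X L \<longleftrightarrow>
     (\<forall>f :: 's \<Rightarrow> real. bounded (f ` S) \<longrightarrow>
        (\<forall>x\<in>S. ((\<lambda>t. ((\<integral>\<omega>. f (X t \<omega>) \<partial>PP x) - f x) / t) \<longlongrightarrow> L f x) (at_right 0)))"

definition prob_measure_on :: "'s set \<Rightarrow> 's measure \<Rightarrow> bool" where
  "prob_measure_on S \<mu> \<longleftrightarrow> prob_space \<mu> \<and> sets \<mu> = sets (count_space S)"

definition law_from ::
  "'s set \<Rightarrow> ('s \<Rightarrow> 'w measure) \<Rightarrow> (real \<Rightarrow> 'w \<Rightarrow> 's) \<Rightarrow> 's measure \<Rightarrow> real \<Rightarrow> 's measure" where
  "law_from S PP X \<mu> t = \<mu> \<bind> (\<lambda>x. distr (PP x) (count_space S) (X t))"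

definition stationary ::
  "'s set \<Rightarrow> ('s \<Rightarrow> 'w measure) \<Rightarrow> (real \<Rightarrow> 'w \<Rightarrow> 's) \<Rightarrow> 's measure \<Rightarrow> bool" where
  "stationary S PP X \<nu> \<longleftrightarrow> prob_measure_on S \<nu> \<and> (\<forall>t\<ge>0. law_from S PP X \<nu> t = \<nu>)"

text \<open>Convergence is weak convergence; \<open>S\<close> is discrete, so every function on it is continuous.\<close>

definition ergodic ::
  "'s set \<Rightarrow> ('s \<Rightarrow> 'w measure) \<Rightarrow> (real \<Rightarrow> 'w \<Rightarrow> 's) \<Rightarrow> bool" where
  "ergodic S PP X \<longleftrightarrow>
     (\<exists>\<nu>. stationary S PP X \<nu> \<and>
        (\<forall>\<nu>'. stationary S PP X \<nu>' \<longrightarrow> \<nu>' = \<nu>) \<and>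
        (\<forall>\<mu>. prob_measure_on S \<mu> \<longrightarrow>
           (\<forall>f :: 's \<Rightarrow> real. bounded (f ` S) \<longrightarrow>
              ((\<lambda>t. \<integral>x. f x \<partial>law_from S PP X \<mu> t) \<longlongrightarrow> (\<integral>x. f x \<partial>\<nu>)) at_top)))"

text \<open>
  The sums and extrema are taken in \<^typ>\<open>ennreal\<close>, so they always exist and the infimum over the
  empty set is infinite.
\<close>

definition max_exit_rate :: "'a set \<Rightarrow> 'a \<Rightarrow> ('a \<Rightarrow> 'a \<Rightarrow> real) \<Rightarrow> ennreal" where
  "max_exit_rate \<Lambda> zero q = (SUP x\<in>\<Lambda>. \<Sum>\<^sub>\<infinity>y\<in>insert zero \<Lambda> - {x}. ennreal (q x y))"

definition ergodicity_coeff :: "'a set \<Rightarrow> ('a \<Rightarrow> 'a \<Rightarrow> real) \<Rightarrow> ennreal" where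
  "ergodicity_coeff \<Lambda> q = (\<Sum>\<^sub>\<infinity>z\<in>\<Lambda>. INF x\<in>\<Lambda> - {z}. ennreal (q x z))"

definition configurations :: "nat \<Rightarrow> 'a set \<Rightarrow> (nat \<Rightarrow> 'a) set" where
  "configurations N \<Lambda> = PiE {1..N} (\<lambda>_. \<Lambda>)"

definition occupation :: "nat \<Rightarrow> (nat \<Rightarrow> 'a) \<Rightarrow> 'a \<Rightarrow> real" where
  "occupation N \<xi> y = (\<Sum>i=1..N. of_bool (\<xi> i = y))"

definition fv_generator ::
  "'a set \<Rightarrow> 'a \<Rightarrow> ('a \<Rightarrow> 'a \<Rightarrow> real) \<Rightarrow> nat \<Rightarrow> ((nat \<Rightarrow> 'a) \<Rightarrow> real) \<Rightarrow> (nat \<Rightarrow> 'a) \<Rightarrow> real" where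
  "fv_generator \<Lambda> zero q N f \<xi> =
     (\<Sum>i=1..N. \<Sum>\<^sub>\<infinity>y\<in>\<Lambda> - {\<xi> i}.
        (q (\<xi> i) y + q (\<xi> i) zero * (occupation N \<xi> y / (real N - 1))) * (f (\<xi>(i := y)) - f \<xi>))"

definition fleming_viot_process ::
  "'a set \<Rightarrow> 'a \<Rightarrow> ('a \<Rightarrow> 'a \<Rightarrow> real) \<Rightarrow> nat \<Rightarrow>
     ((nat \<Rightarrow> 'a) \<Rightarrow> 'w measure) \<Rightarrow> (real \<Rightarrow> 'w \<Rightarrow> nat \<Rightarrow> 'a) \<Rightarrow> bool" where
  "fleming_viot_process \<Lambda> zero q N PP \<Xi> \<longleftrightarrow>
     jump_markov_process (configurations N \<Lambda>) PP \<Xi> \<and>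
     has_generator (configurations N \<Lambda>) PP \<Xi> (fv_generator \<Lambda> zero q N)"

end

theory Submission
  imports Defs
begin

text \<open>
  A positive ergodicity coefficient is a sum with a positive term, so some state \<open>z\<close> of \<open>\<Lambda>\<close> is
  entered from every other state of \<open>\<Lambda>\<close> at rate at least \<open>c > 0\<close>. The idea is that the particles of
  the Fleming-Viot process can then all be collected in \<open>z\<close> within one unit of time, with a
  probability bounded below uniformly in the initial configuration: at most \<open>N\<close> particles have to be
  moved, one after the other, each at rate at least \<open>c\<close>, while the total jump rate of a
  configuration never exceeds some \<open>R\<close>. This is Doeblin's condition, and it implies ergodicity.

  The uniform lower bound is obtained analytically. Write \<open>p t \<xi>\<close> for the probability that the process
  started from \<open>\<xi>\<close> is at time \<open>t\<close> in the configuration with all particles at \<open>z\<close>. The Markov property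
  and the generator equation give Kolmogorov's backward equation for the right derivative of
  \<open>p\<close> in \<open>t\<close> (\<open>kernel_backward_equation\<close>). Only one term of the generator is kept, the one that
  moves a single misplaced particle \<open>j\<close> to \<open>z\<close>; it gives
  \<open>(d/dt) (exp (R t) p t \<xi>) \<ge> c exp (R t) p t (\<xi>(j := z))\<close>, and an induction on the number \<open>k\<close> of
  misplaced particles yields \<open>p t \<xi> \<ge> exp (- R t) (c t) ^ k / k!\<close> (\<open>kernel_lower_bound\<close>).

  The passage from Doeblin's condition to ergodicity is \<open>doeblin_imp_ergodic\<close>. At time \<open>1\<close> the process
  is, with a fixed probability \<open>\<delta>\<close>, at a state that does not depend on where it started. Thus
  one unit of time shrinks the oscillation of any bounded function of the starting
  point by the factor \<open>1 - \<delta>\<close>, which gives convergence and uniqueness, and the state reached after a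
  geometric number of steps since the last forgetting of the past is stationary. This
  argument is carried out for families of probability mass functions, to which the measures
  on the countable state space are first translated.
\<close>

section \<open>Doeblin's condition for semigroups of probability mass functions\<close>

lemma expectation_bind_pmf:
  fixes f :: "'b \<Rightarrow> real"
  assumes "\<And>y. \<bar>f y\<bar> \<le> B"
  shows "measure_pmf.expectation (bind_pmf p k) f = (\<integral>x. measure_pmf.expectation (k x) f \<partial>measure_pmf p)"
  unfolding measure_pmf_bind
  by (rule integral_bind[where K = "count_space UNIV" and B' = 1 and B = B])
     (use assms in \<open>auto simp: measure_pmf.emeasure_space_1 space_subprob_algebra subprob_space_measure_pmf\<close>)

lemma expectation_bounds:
  fixes f :: "'b \<Rightarrow> real"
  assumes "\<And>y. f y \<in> {a..b}"
  shows "measure_pmf.expectation p f \<in> {a..b}"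
proof -
  have "\<bar>f y\<bar> \<le> max \<bar>a\<bar> \<bar>b\<bar>" for y
    using assms[of y] by auto
  then have "integrable p f"
    by (intro measure_pmf.integrable_const_bound[where B = "max \<bar>a\<bar> \<bar>b\<bar>"])
       auto
  then show ?thesis
    using measure_pmf.integral_ge_const[of p f a] measure_pmf.integral_le_const[of p f b] assms by auto
qed

text \<open>
  Sampling from \<open>p\<close> can be done in two steps: with probability \<open>\<delta>\<close> return \<open>z\<close>, otherwise sample from
  the residual law, which is \<open>p\<close> with mass \<open>\<delta>\<close> removed at \<open>z\<close> and renormalized.
\<close>

lemma minorized_pmf_eq_mixture:
  fixes p :: "'s pmf"
  assumes "0 < \<delta>" "\<delta> < 1" "\<delta> \<le> pmf p z"
  obtains r where "p = bind_pmf (bernoulli_pmf \<delta>) (\<lambda>b. if b then return_pmf z else r)"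
proof -
  define h where "h y = (pmf p y - \<delta> * indicator {z} y) / (1 - \<delta>)" for y
  have h_nonneg: "0 \<le> h y" for y
    using assms by (auto simp: h_def indicator_def)
  have "ennreal (1 - \<delta>) * (\<integral>\<^sup>+y. ennreal (h y) \<partial>count_space UNIV) + ennreal \<delta>
      = (\<integral>\<^sup>+y. ennreal ((1 - \<delta>) * h y) \<partial>count_space UNIV) + (\<integral>\<^sup>+y. ennreal \<delta> * indicator {z} y \<partial>count_space UNIV)"
    using assms h_nonneg
    by (simp add: ennreal_mult nn_integral_cmult nn_integral_cmult_indicator one_ennreal_def[symmetric])
  also have "\<dots> = (\<integral>\<^sup>+y. ennreal ((1 - \<delta>) * h y) + ennreal \<delta> * indicator {z} y \<partial>count_space UNIV)"
    by (rule nn_integral_add[symmetric]) auto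
  also have "\<dots> = (\<integral>\<^sup>+y. ennreal (pmf p y) \<partial>count_space UNIV)"
  proof (rule nn_integral_cong)
    fix y
    have "ennreal ((1 - \<delta>) * h y) + ennreal \<delta> * indicator {z} y = ennreal ((1 - \<delta>) * h y + \<delta> * indicator {z} y)"
      using assms h_nonneg by (subst ennreal_plus) (auto simp: indicator_def)
    also have "(1 - \<delta>) * h y + \<delta> * indicator {z} y = pmf p y"
      using assms by (simp add: h_def)
    finally show "ennreal ((1 - \<delta>) * h y) + ennreal \<delta> * indicator {z} y = ennreal (pmf p y)" .
  qed
  also have "\<dots> = 1"
    by (simp add: nn_integral_pmf measure_pmf.emeasure_space_1[simplified])
  finally have sum: "ennreal (1 - \<delta>) * (\<integral>\<^sup>+y. ennreal (h y) \<partial>count_space UNIV) + ennreal \<delta> = 1" .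
  have "(\<integral>\<^sup>+y. ennreal (h y) \<partial>count_space UNIV) = 1"
  proof (cases "\<integral>\<^sup>+y. ennreal (h y) \<partial>count_space UNIV")
    case (real r)
    with sum assms have "ennreal ((1 - \<delta>) * r + \<delta>) = ennreal 1"
      by (simp add: ennreal_mult)
    then have "(1 - \<delta>) * r + \<delta> = 1"
      using real assms by (subst (asm) ennreal_inj) auto
    then have "(1 - \<delta>) * (r - 1) = 0" by (simp add: algebra_simps)
    with assms real show ?thesis by simp
  next
    case top
    with sum assms show ?thesis by (simp add: ennreal_mult_top)
  qed
  then have pmf_h: "pmf (embed_pmf h) y = h y" for y
    using h_nonneg by (simp add: pmf_embed_pmf)
  have "p = bind_pmf (bernoulli_pmf \<delta>) (\<lambda>b. if b then return_pmf z else embed_pmf h)"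
  proof (rule pmf_eqI)
    fix y
    show "pmf p y = pmf (bind_pmf (bernoulli_pmf \<delta>) (\<lambda>b. if b then return_pmf z else embed_pmf h)) y"
      using assms by (simp add: pmf_bind pmf_h h_def indicator_def)
  qed
  then show thesis by (rule that)
qed

text \<open>
  Look at the chain that jumps to \<open>z\<close> with probability \<open>\<delta>\<close> and moves by \<open>r\<close> otherwise. In equilibrium
  the number of steps since its last forced visit to \<open>z\<close> is geometric, and since then it has
  followed \<open>r\<close>. Stationarity of this mixture is the recursion that characterizes the geometric
  law: it is \<open>0\<close> with probability \<open>\<delta>\<close>, and otherwise one more than an independent copy.
\<close>

lemma geometric_mixture_stationary:
  fixes k r :: "'s \<Rightarrow> 's pmf"
  assumes "0 < \<delta>" "\<delta> \<le> 1"
    and "\<And>x. k x = bind_pmf (bernoulli_pmf \<delta>) (\<lambda>b. if b then return_pmf z else r x)"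
  obtains \<nu> where "bind_pmf \<nu> k = \<nu>"
proof -
  define R where "R n = ((\<lambda>p. bind_pmf p r) ^^ n) (return_pmf z)" for n
  define \<nu> where "\<nu> = bind_pmf (geometric_pmf \<delta>) R"
  have shift: "bind_pmf \<nu> r = bind_pmf (geometric_pmf \<delta>) (\<lambda>n. R (Suc n))"
    by (simp add: \<nu>_def R_def bind_assoc_pmf)
  have "bind_pmf \<nu> k = bind_pmf (bernoulli_pmf \<delta>) (\<lambda>b. bind_pmf \<nu> (\<lambda>x. if b then return_pmf z else r x))"
    unfolding assms(3) by (rule bind_commute_pmf)
  also have "\<dots> = bind_pmf (bernoulli_pmf \<delta>)
      (\<lambda>b. bind_pmf (if b then return_pmf 0 else map_pmf Suc (geometric_pmf \<delta>)) R)"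
    by (intro bind_pmf_cong refl) (simp add: shift bind_return_pmf bind_map_pmf R_def)
  also have "\<dots> = bind_pmf (bind_pmf (bernoulli_pmf \<delta>)
      (\<lambda>b. if b then return_pmf 0 else map_pmf Suc (geometric_pmf \<delta>))) R"
    by (simp add: bind_assoc_pmf)
  also have "\<dots> = \<nu>"
    unfolding \<nu>_def using geometric_bind_pmf_unfold[of \<delta>] assms by auto
  finally show thesis by (rule that)
qed

text \<open>
  Over one unit of time the value \<open>f z\<close> enters with the weight \<open>\<delta>\<close> whatever the starting point, so
  the expectations of \<open>f\<close> from all starting points lie in an interval shorter by the factor
  \<open>1 - \<delta>\<close>. Applying this to the last unit of time and repeating it with the resulting function
  gives the claim, uniformly in all times beyond \<open>n\<close>.
\<close>

lemma mixture_contraction: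
  fixes K :: "real \<Rightarrow> 's \<Rightarrow> 's pmf" and f :: "'s \<Rightarrow> real"
  assumes semigroup: "\<And>s t x. 0 \<le> s \<Longrightarrow> 0 \<le> t \<Longrightarrow> K (s + t) x = bind_pmf (K s x) (K t)"
    and \<delta>: "0 < \<delta>" "\<delta> < 1"
    and mix: "\<And>x. K 1 x = bind_pmf (bernoulli_pmf \<delta>) (\<lambda>b. if b then return_pmf z else r x)"
    and f: "\<And>x. f x \<in> {a..b}"
  shows "\<exists>a' b'. b' - a' = (1 - \<delta>) ^ n * (b - a) \<and>
           (\<forall>t\<ge>real n. \<forall>x. measure_pmf.expectation (K t x) f \<in> {a'..b'})"
  using f
proof (induction n arbitrary: f a b)
  case 0
  then show ?case
    using expectation_bounds[of f a b] by (intro exI[of _ a] exI[of _ b]) auto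
next
  case (Suc n)
  have fB: "\<bar>f y\<bar> \<le> max \<bar>a\<bar> \<bar>b\<bar>" for y
    using Suc.prems[of y] by auto
  define g where "g x = measure_pmf.expectation (K 1 x) f" for x
  have g: "g x \<in> {\<delta> * f z + (1 - \<delta>) * a .. \<delta> * f z + (1 - \<delta>) * b}" for x
  proof -
    have "g x = \<delta> * f z + (1 - \<delta>) * measure_pmf.expectation (r x) f"
      using \<delta> unfolding g_def mix by (subst expectation_bind_pmf[OF fB]) simp_all
    moreover have "measure_pmf.expectation (r x) f \<in> {a..b}"
      by (rule expectation_bounds) (rule Suc.prems)
    ultimately show ?thesis
      using \<delta> by (auto intro!: mult_left_mono)
  qed
  obtain a' b' where ab: "b' - a' = (1 - \<delta>) ^ n * ((\<delta> * f z + (1 - \<delta>) * b) - (\<delta> * f z + (1 - \<delta>) * a))"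
    "\<And>t x. real n \<le> t \<Longrightarrow> measure_pmf.expectation (K t x) g \<in> {a'..b'}"
    using Suc.IH[of g, OF g] by blast
  have "measure_pmf.expectation (K t x) f \<in> {a'..b'}" if "real (Suc n) \<le> t" for t x
  proof -
    have "K t x = bind_pmf (K (t - 1) x) (K 1)"
      using semigroup[of "t - 1" 1 x] that by simp
    then have "measure_pmf.expectation (K t x) f = measure_pmf.expectation (K (t - 1) x) g"
      by (simp add: expectation_bind_pmf[OF fB] g_def[abs_def])
    then show ?thesis using ab(2)[of "t - 1" x] that by simp
  qed
  then show ?case
    using ab(1) by (intro exI[of _ a'] exI[of _ b']) (auto simp: algebra_simps)
qed

lemma doeblin_pmf_semigroup:
  fixes K :: "real \<Rightarrow> 's \<Rightarrow> 's pmf"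
  assumes semigroup: "\<And>s t x. 0 \<le> s \<Longrightarrow> 0 \<le> t \<Longrightarrow> K (s + t) x = bind_pmf (K s x) (K t)"
    and "0 < \<delta>" and "\<And>x. \<delta> \<le> pmf (K 1 x) z"
  obtains \<nu> where "\<And>t. 0 \<le> t \<Longrightarrow> bind_pmf \<nu> (K t) = \<nu>"
    and "\<And>\<mu> (f :: 's \<Rightarrow> real) B. (\<And>x. \<bar>f x\<bar> \<le> B) \<Longrightarrow>
      ((\<lambda>t. measure_pmf.expectation (bind_pmf \<mu> (K t)) f) \<longlongrightarrow> measure_pmf.expectation \<nu> f) at_top"
proof -
  \<comment> \<open>The mixture decomposition divides by \<open>1 - \<delta>\<close>, hence the passage to a constant below \<open>1\<close>.\<close>
  define \<epsilon> where "\<epsilon> = min \<delta> (1/2)"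
  have \<epsilon>: "0 < \<epsilon>" "\<epsilon> < 1" "\<And>x. \<epsilon> \<le> pmf (K 1 x) z"
    using assms(2,3) by (auto simp: \<epsilon>_def intro: min.coboundedI1)
  have "\<exists>r. K 1 x = bind_pmf (bernoulli_pmf \<epsilon>) (\<lambda>b. if b then return_pmf z else r)" for x
    using minorized_pmf_eq_mixture[OF \<epsilon>(1,2) \<epsilon>(3)[of x]] by metis
  then obtain r where mix: "\<And>x. K 1 x = bind_pmf (bernoulli_pmf \<epsilon>) (\<lambda>b. if b then return_pmf z else r x)"
    by metis
  obtain \<nu> where \<nu>: "bind_pmf \<nu> (K 1) = \<nu>"
    using geometric_mixture_stationary[of \<epsilon> "K 1" z r] \<epsilon> mix by force
  have contraction: "\<bar>measure_pmf.expectation (bind_pmf p (K t)) f - measure_pmf.expectation (bind_pmf p' (K t)) f\<bar>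
      \<le> (1 - \<epsilon>) ^ n * (2 * B)" if f: "\<And>x. \<bar>f x\<bar> \<le> B" and "real n \<le> t" for p p' f B n t
  proof -
    have "f x \<in> {- B..B}" for x
      using f[of x] by auto
    with mixture_contraction[OF semigroup \<epsilon>(1,2) mix, of f "- B" B n]
    obtain a b where ab: "b - a = (1 - \<epsilon>) ^ n * (2 * B)"
      "\<And>t x. real n \<le> t \<Longrightarrow> measure_pmf.expectation (K t x) f \<in> {a..b}"
      by auto
    have "measure_pmf.expectation (bind_pmf p (K t)) f \<in> {a..b}" for p
      unfolding expectation_bind_pmf[OF f] using ab(2)[OF \<open>real n \<le> t\<close>] by (rule expectation_bounds)
    from this[of p] this[of p'] ab(1) show ?thesis by auto
  qed
  have pow0: "(\<lambda>n. (1 - \<epsilon>) ^ n * (2 * B)) \<longlonglongrightarrow> 0" for B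
    using tendsto_mult_right[OF LIMSEQ_realpow_zero[of "1 - \<epsilon>"], of "2 * B"] \<epsilon> by simp
  have stat_K_nat: "bind_pmf p (K (real n + 1)) = p" if "bind_pmf p (K 1) = p" for p n
  proof (induction n)
    case (Suc n)
    have "bind_pmf p (K (real (Suc n) + 1)) = bind_pmf (bind_pmf p (K (real n + 1))) (K 1)"
      using semigroup[of "real n + 1" 1] by (simp add: bind_assoc_pmf add_ac cong: bind_pmf_cong)
    then show ?case using Suc that by simp
  qed (use that in simp)
  have unique: "p = p'" if "bind_pmf p (K 1) = p" "bind_pmf p' (K 1) = p'" for p p'
  proof (rule pmf_eqI)
    fix y
    have "\<bar>pmf p y - pmf p' y\<bar> \<le> (1 - \<epsilon>) ^ n * (2 * 1)" for n
      using contraction[of "indicator {y}" 1 n "real n + 1" p p'] stat_K_nat that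
      by (simp add: indicator_def pmf.rep_eq)
    then have "\<bar>pmf p y - pmf p' y\<bar> \<le> 0"
      by (intro LIMSEQ_le_const[OF pow0[of 1]]) auto
    then show "pmf p y = pmf p' y" by simp
  qed
  \<comment> \<open>\<open>K t\<close> commutes with \<open>K 1\<close>, so it maps \<open>\<nu>\<close> to a law that is again invariant under \<open>K 1\<close>.\<close>
  have stat: "bind_pmf \<nu> (K t) = \<nu>" if "0 \<le> t" for t
  proof (rule unique)
    have "bind_pmf (bind_pmf \<nu> (K t)) (K 1) = bind_pmf \<nu> (K (1 + t))"
      using semigroup[of t 1] that by (simp add: bind_assoc_pmf add_ac cong: bind_pmf_cong)
    also have "\<dots> = bind_pmf (bind_pmf \<nu> (K 1)) (K t)"
      using semigroup[of 1 t] that by (simp add: bind_assoc_pmf cong: bind_pmf_cong)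
    finally show "bind_pmf (bind_pmf \<nu> (K t)) (K 1) = bind_pmf \<nu> (K t)"
      using \<nu> by simp
  qed (fact \<nu>)
  show thesis
  proof (rule that[OF stat])
    fix \<mu> and f :: "'s \<Rightarrow> real" and B
    assume f: "\<And>x. \<bar>f x\<bar> \<le> B"
    show "((\<lambda>t. measure_pmf.expectation (bind_pmf \<mu> (K t)) f) \<longlongrightarrow> measure_pmf.expectation \<nu> f) at_top"
    proof (rule tendstoI)
      fix e :: real assume "0 < e"
      then obtain n where n: "(1 - \<epsilon>) ^ n * (2 * B) < e"
        using order_tendstoD(2)[OF pow0[of B]] by (auto simp: eventually_sequentially)
      show "\<forall>\<^sub>F t in at_top. dist (measure_pmf.expectation (bind_pmf \<mu> (K t)) f) (measure_pmf.expectation \<nu> f) < e"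
        using eventually_ge_at_top[of "real n"]
      proof eventually_elim
        case (elim t)
        then show ?case
          using contraction[of f B n t \<mu> \<nu>, OF f] stat[of t] n by (simp add: dist_real_def)
      qed
    qed
  qed
qed

section \<open>Transition kernels of Markov jump processes\<close>

text \<open>
  A probability mass function lives on the whole type, the measures considered here live on \<open>S\<close>;
  restricting the former to \<open>S\<close> gives the translation between the two. Every probability measure
  on \<open>S\<close> arises in this way because, \<open>S\<close> being countable, it is concentrated on its atoms.
\<close>

lemma prob_measure_on_imp_pmf:
  assumes "countable S" "prob_measure_on S \<mu>"
  obtains p where "set_pmf p \<subseteq> S" "\<mu> = restrict_space (measure_pmf p) S"
proof -
  interpret prob_space \<mu> using assms by (simp add: prob_measure_on_def)
  have sets: "sets \<mu> = sets (count_space S)" using assms by (simp add: prob_measure_on_def)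
  then have space: "space \<mu> = S" by (metis sets_eq_imp_space_eq space_count_space)
  define M where "M = distr \<mu> (count_space UNIV) (\<lambda>x. x)"
  have meas: "(\<lambda>x. x) \<in> measurable \<mu> (count_space UNIV)"
    using sets space by (auto intro!: measurableI)
  interpret M: prob_space M unfolding M_def by (rule prob_space_distr[OF meas])
  have "AE x in M. x \<in> S"
    unfolding M_def by (subst AE_distr_iff[OF meas]) (auto simp: space[symmetric])
  then have "AE x in M. measure M {x} \<noteq> 0"
    using assms(1) by (subst M.AE_support_countable) (auto simp: M_def)
  then have M_pmf: "measure_pmf (Abs_pmf M) = M"
    by (intro Abs_pmf_inverse) (auto simp: M.prob_space_axioms, simp add: M_def)
  have "AE x in measure_pmf (Abs_pmf M). x \<in> S"
    unfolding M_pmf by fact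
  then have supp: "set_pmf (Abs_pmf M) \<subseteq> S"
    by (auto simp: AE_measure_pmf_iff)
  have "\<mu> = restrict_space (measure_pmf (Abs_pmf M)) S"
  proof (rule measure_eqI)
    show "sets \<mu> = sets (restrict_space (measure_pmf (Abs_pmf M)) S)"
      by (auto simp: sets sets_restrict_space)
    fix A assume "A \<in> sets \<mu>"
    with sets have "A \<subseteq> S" by simp
    then show "emeasure \<mu> A = emeasure (restrict_space (measure_pmf (Abs_pmf M)) S) A"
      unfolding M_pmf using space
      by (subst emeasure_restrict_space)
        (auto simp: M_def emeasure_distr[OF meas] intro!: arg_cong[where f = "emeasure \<mu>"])
  qed
  with supp show thesis by (rule that)
qed

lemma prob_measure_on_restrict_pmf:
  assumes "set_pmf p \<subseteq> S"
  shows "prob_measure_on S (restrict_space (measure_pmf p) S)"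
proof -
  have "emeasure (measure_pmf p) S = 1"
    using assms by (intro measure_pmf.emeasure_eq_1_AE) (auto simp: AE_measure_pmf_iff)
  then show ?thesis
    unfolding prob_measure_on_def
    by (auto intro!: prob_space_restrict_space simp: sets_restrict_space)
qed

lemma restrict_pmf_inject:
  assumes "set_pmf p \<subseteq> S" "set_pmf p' \<subseteq> S"
    and "restrict_space (measure_pmf p) S = restrict_space (measure_pmf p') S"
  shows "p = p'"
proof (rule pmf_eqI)
  fix y
  show "pmf p y = pmf p' y"
  proof (cases "y \<in> S")
    case True
    then have "measure (restrict_space (measure_pmf p) S) {y} = measure (restrict_space (measure_pmf p') S) {y}"
      by (simp add: assms(3))
    with True show ?thesis by (simp add: measure_restrict_space pmf.rep_eq)
  next
    case False
    with assms(1,2) have "y \<notin> set_pmf p" "y \<notin> set_pmf p'" by auto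
    then show ?thesis by (simp add: set_pmf_iff)
  qed
qed

lemma integral_restrict_pmf:
  fixes f :: "'s \<Rightarrow> real"
  assumes "set_pmf p \<subseteq> S" "\<And>x. x \<in> S \<Longrightarrow> f x = g x"
  shows "integral\<^sup>L (restrict_space (measure_pmf p) S) f = measure_pmf.expectation p g"
  using assms by (subst integral_restrict_space)
    (auto intro!: integral_cong_AE simp: AE_measure_pmf_iff indicator_def)

text \<open>
  A family of probability mass functions that represents the one-dimensional laws of the process.
  Its values at starting points outside \<open>S\<close> and at negative times are left open.
\<close>

definition transition_kernel ::
  "'s set \<Rightarrow> ('s \<Rightarrow> 'w measure) \<Rightarrow> (real \<Rightarrow> 'w \<Rightarrow> 's) \<Rightarrow> (real \<Rightarrow> 's \<Rightarrow> 's pmf) \<Rightarrow> bool" where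
  "transition_kernel S PP X K \<longleftrightarrow>
     (\<forall>t\<ge>0. \<forall>x\<in>S. set_pmf (K t x) \<subseteq> S \<and>
        distr (PP x) (count_space S) (X t) = restrict_space (measure_pmf (K t x)) S)"

text \<open>
  Starting points outside \<open>S\<close> are treated as if they were \<open>z\<close>. With this convention the semigroup
  property and Doeblin's condition, once known on \<open>S\<close>, hold at all points of the type.
\<close>

lemma ex_transition_kernel:
  assumes "countable S" "jump_markov_process S PP X" "z \<in> S"
  obtains K where "transition_kernel S PP X K" "\<And>t x. x \<notin> S \<Longrightarrow> K t x = K t z"
proof -
  have "\<exists>p. set_pmf p \<subseteq> S \<and> distr (PP x) (count_space S) (X t) = restrict_space (measure_pmf p) S"
    if "x \<in> S" "0 \<le> t" for x t
  proof -
    have "prob_space (PP x)" "X t \<in> measurable (PP x) (count_space S)"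
      using assms that by (auto simp: jump_markov_process_def)
    then have "prob_measure_on S (distr (PP x) (count_space S) (X t))"
      unfolding prob_measure_on_def by (auto intro: prob_space.prob_space_distr)
    from prob_measure_on_imp_pmf[OF assms(1) this] show ?thesis by metis
  qed
  then have "\<forall>t x. \<exists>p. x \<in> S \<longrightarrow> 0 \<le> t \<longrightarrow> set_pmf p \<subseteq> S \<and>
      distr (PP x) (count_space S) (X t) = restrict_space (measure_pmf p) S"
    by blast
  then obtain K0 where K0: "\<And>x t. x \<in> S \<Longrightarrow> 0 \<le> t \<Longrightarrow> set_pmf (K0 t x) \<subseteq> S \<and>
      distr (PP x) (count_space S) (X t) = restrict_space (measure_pmf (K0 t x)) S"
    unfolding choice_iff by blast
  show thesis
    by (rule that[of "\<lambda>t x. K0 t (if x \<in> S then x else z)"])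
      (use K0 assms(3) in \<open>auto simp: transition_kernel_def\<close>)
qed

context
  fixes S :: "'s set" and PP :: "'s \<Rightarrow> 'w measure" and X :: "real \<Rightarrow> 'w \<Rightarrow> 's" and K :: "real \<Rightarrow> 's \<Rightarrow> 's pmf"
  assumes S: "countable S" and markov: "jump_markov_process S PP X" and K: "transition_kernel S PP X K"
begin

lemma set_pmf_kernel: "0 \<le> t \<Longrightarrow> x \<in> S \<Longrightarrow> set_pmf (K t x) \<subseteq> S"
  using K by (simp add: transition_kernel_def)

lemma expectation_kernel:
  fixes f :: "'s \<Rightarrow> real"
  assumes "0 \<le> t" "x \<in> S"
  shows "(\<integral>\<omega>. f (X t \<omega>) \<partial>PP x) = measure_pmf.expectation (K t x) f"
proof -
  have "(\<integral>\<omega>. f (X t \<omega>) \<partial>PP x) = integral\<^sup>L (distr (PP x) (count_space S) (X t)) f"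
    using markov assms by (intro integral_distr[symmetric]) (auto simp: jump_markov_process_def)
  also have "\<dots> = integral\<^sup>L (restrict_space (measure_pmf (K t x)) S) f"
    using K assms by (simp add: transition_kernel_def)
  also have "\<dots> = measure_pmf.expectation (K t x) f"
    using set_pmf_kernel[OF assms] by (rule integral_restrict_pmf) simp
  finally show ?thesis .
qed

lemma sets_kernel_events:
  "0 \<le> t \<Longrightarrow> x \<in> S \<Longrightarrow> {\<omega> \<in> space (PP x). X t \<omega> = y} \<in> sets (PP x)"
proof -
  assume "0 \<le> t" "x \<in> S"
  then have meas: "X t \<in> measurable (PP x) (count_space S)"
    using markov by (simp add: jump_markov_process_def)
  have "{\<omega> \<in> space (PP x). X t \<omega> = y} = X t -` ({y} \<inter> S) \<inter> space (PP x)"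
    using measurable_space[OF meas] by auto
  also have "\<dots> \<in> sets (PP x)" using meas by (rule measurable_sets) simp
  finally show ?thesis .
qed

lemma trans_prob_eq_pmf:
  assumes "0 \<le> t" "x \<in> S"
  shows "trans_prob PP X t x y = pmf (K t x) y"
proof -
  have "trans_prob PP X t x y = (\<integral>\<omega>. indicator {\<omega> \<in> space (PP x). X t \<omega> = y} \<omega> \<partial>PP x)"
    using sets_kernel_events[OF assms] by (simp add: trans_prob_def)
  also have "\<dots> = (\<integral>\<omega>. indicator {y} (X t \<omega>) \<partial>PP x)"
    by (rule Bochner_Integration.integral_cong) (auto simp: indicator_def)
  also have "\<dots> = pmf (K t x) y"
    by (subst expectation_kernel[OF assms]) (simp add: pmf.rep_eq)
  finally show ?thesis .
qed

lemma kernel_0: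
  assumes "x \<in> S"
  shows "K 0 x = return_pmf x"
proof -
  interpret prob_space "PP x" using markov assms by (simp add: jump_markov_process_def)
  have "AE \<omega> in PP x. X 0 \<omega> = x"
    using markov assms by (simp add: jump_markov_process_def)
  then have "prob {\<omega> \<in> space (PP x). X 0 \<omega> = x} = 1"
    using sets_kernel_events[of 0 x x] assms by (intro prob_Collect_eq_1[THEN iffD2]) auto
  then have "pmf (K 0 x) x = 1"
    using trans_prob_eq_pmf[of 0 x x] assms by (simp add: trans_prob_def)
  then have "AE y in K 0 x. y \<in> {x}"
    by (subst measure_pmf.prob_eq_1[symmetric]) (simp_all add: pmf.rep_eq)
  then have "set_pmf (K 0 x) \<subseteq> {x}"
    by (auto simp: AE_measure_pmf_iff)
  then show ?thesis by (simp add: set_pmf_subset_singleton)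
qed

lemma chapman_kolmogorov:
  assumes "0 \<le> s" "0 \<le> t" "x \<in> S"
  shows "K (s + t) x = bind_pmf (K s x) (K t)"
proof (rule pmf_eqI)
  fix y
  interpret prob_space "PP x" using markov assms by (simp add: jump_markov_process_def)
  show "pmf (K (s + t) x) y = pmf (bind_pmf (K s x) (K t)) y"
  proof (cases "y \<in> S")
    case False
    moreover have "set_pmf (bind_pmf (K s x) (K t)) \<subseteq> S"
      using set_pmf_kernel[of s x] set_pmf_kernel[of t] assms by (auto; blast)
    ultimately have "y \<notin> set_pmf (K (s + t) x)" "y \<notin> set_pmf (bind_pmf (K s x) (K t))"
      using set_pmf_kernel[of "s + t" x] assms by auto
    then show ?thesis by (metis pmf_eq_0_set_pmf)
  next
    case True
    have joint: "prob {\<omega> \<in> space (PP x). X s \<omega> = a \<and> X (s + t) \<omega> = y} = pmf (K s x) a * pmf (K t a) y"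
      if "a \<in> S" for a
    proof -
      \<comment> \<open>The Markov property is stated for infinite sequences of times and states, so the two
        times and the two states are continued as constants.\<close>
      define u :: "nat \<Rightarrow> real" where "u i = (if i = 0 then s else s + t)" for i
      define b where "b i = (if i = 0 then a else y)" for i :: nat
      have "0 \<le> u 0" "mono u" "\<forall>i. b i \<in> S"
        using assms that True by (auto simp: u_def b_def mono_def)
      with markov \<open>x \<in> S\<close> have
        "\<P>(\<omega> in PP x. \<forall>i\<le>Suc 0. X (u i) \<omega> = b i) =
          \<P>(\<omega> in PP x. \<forall>i\<le>0. X (u i) \<omega> = b i) * trans_prob PP X (u (Suc 0) - u 0) (b 0) (b (Suc 0))"
        unfolding jump_markov_process_def by blast
      moreover have "(\<forall>i\<le>Suc 0. X (u i) \<omega> = b i) \<longleftrightarrow> X s \<omega> = a \<and> X (s + t) \<omega> = y" for \<omega>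
        by (auto simp: u_def b_def le_Suc_eq)
      ultimately show ?thesis
        using trans_prob_eq_pmf[OF \<open>0 \<le> t\<close> that] trans_prob_eq_pmf[OF \<open>0 \<le> s\<close> \<open>x \<in> S\<close>, of a]
        by (simp add: u_def b_def trans_prob_def[of PP X s x a])
    qed
    have X_S: "X s \<omega> \<in> S" if "\<omega> \<in> space (PP x)" for \<omega>
      using markov \<open>0 \<le> s\<close> \<open>x \<in> S\<close> measurable_space[OF _ that, of "X s" "count_space S"]
      by (simp add: jump_markov_process_def)
    have "ennreal (pmf (K (s + t) x) y) = \<P>(\<omega> in PP x. \<exists>a\<in>S. X s \<omega> = a \<and> X (s + t) \<omega> = y)"
      unfolding trans_prob_eq_pmf[of "s + t" x y, OF add_nonneg_nonneg[OF assms(1,2)] assms(3), symmetric]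
        trans_prob_def
      using X_S by (intro arg_cong[where f = "\<lambda>A. ennreal (prob A)"]) auto
    also have "\<dots> = (\<integral>\<^sup>+a. \<P>(\<omega> in PP x. X s \<omega> = a \<and> X (s + t) \<omega> = y) \<partial>count_space S)"
      using S sets_kernel_events assms by (intro prob_EX_countable sets.sets_Collect_conj) auto
    also have "\<dots> = (\<integral>\<^sup>+a. ennreal (pmf (K s x) a) * ennreal (pmf (K t a) y) \<partial>count_space S)"
      by (rule nn_integral_cong) (simp add: joint ennreal_mult)
    also have "\<dots> = (\<integral>\<^sup>+a. ennreal (pmf (K s x) a) * ennreal (pmf (K t a) y) \<partial>count_space UNIV)"
      using set_pmf_kernel[OF assms(1,3)]
      by (intro nn_integral_count_space_eq) (auto simp: set_pmf_iff)
    also have "\<dots> = ennreal (pmf (bind_pmf (K s x) (K t)) y)"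
      by (simp add: ennreal_pmf_bind nn_integral_measure_pmf)
    finally show ?thesis by simp
  qed
qed

lemma law_from_restrict_pmf:
  assumes "0 \<le> t" "set_pmf p \<subseteq> S"
  shows "law_from S PP X (restrict_space (measure_pmf p) S) t = restrict_space (measure_pmf (bind_pmf p (K t))) S"
proof -
  let ?k = "\<lambda>x. distr (PP x) (count_space S) (X t)" and ?p = "restrict_space (measure_pmf p) S"
  have p: "prob_measure_on S ?p" using assms(2) by (rule prob_measure_on_restrict_pmf)
  have "?p \<bind> ?k = ?p \<bind> (\<lambda>x. restrict_space (measure_pmf (K t x)) S)"
    using K assms(1) by (intro bind_cong) (auto simp: transition_kernel_def space_restrict_space)
  have k: "?k \<in> measurable ?p (subprob_algebra (count_space S))"
  proof (rule measurableI)
    fix x assume "x \<in> space ?p"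
    then have "x \<in> S" by (simp add: space_restrict_space)
    then have "prob_space (?k x)"
      using markov assms by (auto simp: jump_markov_process_def intro!: prob_space.prob_space_distr)
    then show "?k x \<in> space (subprob_algebra (count_space S))"
      by (simp add: space_subprob_algebra prob_space_imp_subprob_space)
  qed (auto simp: sets_restrict_space)
  have ne: "space ?p \<noteq> {}"
    using p prob_space.not_empty[of ?p] by (simp add: prob_measure_on_def)
  show ?thesis unfolding law_from_def
  proof (rule measure_eqI_countable[where A = S])
    show "sets (?p \<bind> ?k) = Pow S"
      using k ne by (subst sets_bind[where N = "count_space S"]) (auto dest: measurable_space simp: space_subprob_algebra)
    show "sets (restrict_space (measure_pmf (bind_pmf p (K t))) S) = Pow S"
      by (auto simp: sets_restrict_space)
    fix y assume y: "y \<in> S"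
    have "emeasure (?p \<bind> ?k) {y} = (\<integral>\<^sup>+x. emeasure (?k x) {y} \<partial>?p)"
      using ne k y by (intro emeasure_bind) auto
    also have "\<dots> = (\<integral>\<^sup>+x. emeasure (?k x) {y} * indicator S x \<partial>measure_pmf p)"
      by (subst nn_integral_restrict_space) auto
    also have "\<dots> = (\<integral>\<^sup>+x. ennreal (pmf (K t x) y) \<partial>measure_pmf p)"
      using assms y K
      by (intro nn_integral_cong_AE)
        (auto simp: AE_measure_pmf_iff transition_kernel_def indicator_def emeasure_restrict_space emeasure_pmf_single)
    also have "\<dots> = emeasure (restrict_space (measure_pmf (bind_pmf p (K t))) S) {y}"
      using y by (simp add: emeasure_restrict_space emeasure_pmf_single ennreal_pmf_bind)
    finally show "emeasure (?p \<bind> ?k) {y} = emeasure (restrict_space (measure_pmf (bind_pmf p (K t))) S) {y}" .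
  qed (use S in auto)
qed

end

text \<open>
  Restriction to \<open>S\<close> is injective, preserves integrals and turns \<open>bind_pmf p (K t)\<close> into the law at
  time \<open>t\<close> started from \<open>p\<close>; this carries existence, uniqueness and convergence over from
  \<open>doeblin_pmf_semigroup\<close>.
\<close>

lemma doeblin_imp_ergodic:
  assumes S: "countable S" and markov: "jump_markov_process S PP X"
    and z: "z \<in> S" and "0 < \<delta>" and minor: "\<And>x. x \<in> S \<Longrightarrow> \<delta> \<le> trans_prob PP X 1 x z"
  shows "ergodic S PP X"
proof -
  obtain K where K: "transition_kernel S PP X K" and ext: "\<And>t x. x \<notin> S \<Longrightarrow> K t x = K t z"
    using ex_transition_kernel[OF S markov z] by metis
  note kernel = S markov K
  have supp: "set_pmf (K t x) \<subseteq> S" if "0 \<le> t" for t x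
    using set_pmf_kernel[OF kernel that] z ext by (cases "x \<in> S") auto
  have "K (s + t) x = bind_pmf (K s x) (K t)" if "0 \<le> s" "0 \<le> t" for s t x
    using chapman_kolmogorov[OF kernel that] z ext by (cases "x \<in> S") auto
  moreover have "\<delta> \<le> pmf (K 1 x) z" for x
    using minor[of x] minor[of z] z ext[of x 1] trans_prob_eq_pmf[OF kernel, of 1]
    by (cases "x \<in> S") auto
  ultimately obtain \<nu> where stat: "\<And>t. 0 \<le> t \<Longrightarrow> bind_pmf \<nu> (K t) = \<nu>"
    and conv: "\<And>\<mu> (f :: 'a \<Rightarrow> real) B. (\<And>x. \<bar>f x\<bar> \<le> B) \<Longrightarrow>
      ((\<lambda>t. measure_pmf.expectation (bind_pmf \<mu> (K t)) f) \<longlongrightarrow> measure_pmf.expectation \<nu> f) at_top"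
    using doeblin_pmf_semigroup[of K \<delta> z] \<open>0 < \<delta>\<close> by metis
  have \<nu>_S: "set_pmf \<nu> \<subseteq> S"
    using stat[of 0] supp[of 0] by (metis SUP_least order_refl set_bind_pmf)
  let ?\<nu> = "restrict_space (measure_pmf \<nu>) S"
  have "stationary S PP X ?\<nu>"
    unfolding stationary_def
    using prob_measure_on_restrict_pmf[OF \<nu>_S] law_from_restrict_pmf[OF kernel _ \<nu>_S] stat by simp
  moreover have "\<nu>' = ?\<nu>" if stat': "stationary S PP X \<nu>'" for \<nu>'
  proof -
    obtain p where p: "set_pmf p \<subseteq> S" "\<nu>' = restrict_space (measure_pmf p) S"
      using prob_measure_on_imp_pmf[OF S] stat' by (auto simp: stationary_def)
    have p_stat: "bind_pmf p (K t) = p" if "0 \<le> t" for t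
      using stat' that law_from_restrict_pmf[OF kernel that p(1)] p supp[OF that]
      by (intro restrict_pmf_inject[of _ S]) (auto simp: stationary_def)
    have "p = \<nu>"
    proof (rule pmf_eqI)
      fix y
      have "((\<lambda>t. measure_pmf.expectation (bind_pmf p (K t)) (indicator {y})) \<longlongrightarrow>
          measure_pmf.expectation \<nu> (indicator {y} :: _ \<Rightarrow> real)) at_top"
        by (rule conv[of _ 1]) (simp add: indicator_def)
      moreover have "\<forall>\<^sub>F t in at_top. measure_pmf.expectation (bind_pmf p (K t)) (indicator {y}) = pmf p y"
        using eventually_ge_at_top[of 0] by eventually_elim (simp add: p_stat pmf.rep_eq)
      ultimately have "((\<lambda>t::real. pmf p y) \<longlongrightarrow> pmf \<nu> y) at_top"
        by (simp add: tendsto_cong pmf.rep_eq)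
      then show "pmf p y = pmf \<nu> y"
        by (simp add: tendsto_const_iff)
    qed
    with p show ?thesis by simp
  qed
  moreover have "((\<lambda>t. \<integral>x. f x \<partial>law_from S PP X \<mu> t) \<longlongrightarrow> (\<integral>x. f x \<partial>?\<nu>)) at_top"
    if \<mu>: "prob_measure_on S \<mu>" and f: "bounded (f ` S)" for \<mu> and f :: "'a \<Rightarrow> real"
  proof -
    obtain p where p: "set_pmf p \<subseteq> S" "\<mu> = restrict_space (measure_pmf p) S"
      using prob_measure_on_imp_pmf[OF S \<mu>] by metis
    obtain B where B: "\<And>x. x \<in> S \<Longrightarrow> \<bar>f x\<bar> \<le> B"
      using f by (auto simp: bounded_iff)
    define g where "g x = (if x \<in> S then f x else 0)" for x
    have "\<bar>g x\<bar> \<le> \<bar>B\<bar>" for x using B[of x] by (auto simp: g_def)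
    from conv[of g, OF this, of p]
    have "((\<lambda>t. measure_pmf.expectation (bind_pmf p (K t)) g) \<longlongrightarrow> measure_pmf.expectation \<nu> g) at_top" .
    moreover have "measure_pmf.expectation \<nu> g = (\<integral>x. f x \<partial>?\<nu>)"
      using \<nu>_S by (intro integral_restrict_pmf[symmetric]) (auto simp: g_def)
    moreover have "\<forall>\<^sub>F t in at_top. measure_pmf.expectation (bind_pmf p (K t)) g = (\<integral>x. f x \<partial>law_from S PP X \<mu> t)"
      using eventually_ge_at_top[of 0]
    proof eventually_elim
      case (elim t)
      have "(\<integral>x. f x \<partial>restrict_space (measure_pmf (bind_pmf p (K t))) S) = measure_pmf.expectation (bind_pmf p (K t)) g"
        using supp[OF elim] by (intro integral_restrict_pmf) (auto simp: g_def)
      then show ?case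
        unfolding p(2) law_from_restrict_pmf[OF kernel elim p(1)] by simp
    qed
    ultimately show ?thesis by (simp add: tendsto_cong)
  qed
  ultimately show ?thesis unfolding ergodic_def by blast
qed

section \<open>Lower bounds from the backward equation\<close>

text \<open>
  The backward equation only provides right derivatives, for which the mean value theorem is not
  applicable. Instead, after adding a small positive slope, a maximum of the function
  can only be attained at the right end of the interval.
\<close>

lemma mono_if_right_derivative_nonneg:
  fixes f :: "real \<Rightarrow> real"
  assumes "a \<le> b" and cont: "continuous_on {a..b} f"
    and deriv: "\<And>t. a \<le> t \<Longrightarrow> t < b \<Longrightarrow> \<exists>D\<ge>0. (f has_real_derivative D) (at_right t)"
  shows "f a \<le> f b"
proof -
  have tilted: "f a \<le> f b + \<epsilon> * (b - a)" if "0 < \<epsilon>" for \<epsilon>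
  proof -
    define g where "g t = f t + \<epsilon> * t" for t
    have "continuous_on {a..b} g"
      unfolding g_def using cont by (intro continuous_intros)
    then obtain m where m: "m \<in> {a..b}" "\<And>t. t \<in> {a..b} \<Longrightarrow> g t \<le> g m"
      using continuous_attains_sup[of "{a..b}" g] \<open>a \<le> b\<close> by auto
    have "m = b"
    proof (rule ccontr)
      assume "m \<noteq> b"
      with m have "a \<le> m" "m < b" by auto
      then obtain D where D: "0 \<le> D" "(f has_real_derivative D) (at_right m)"
        using deriv by blast
      then have "(g has_real_derivative D + \<epsilon>) (at_right m)"
        unfolding g_def by (auto intro!: derivative_eq_intros)
      from has_real_derivative_pos_inc_right[OF this] D(1) \<open>0 < \<epsilon>\<close>
      obtain d where d: "0 < d" "\<And>h. 0 < h \<Longrightarrow> h < d \<Longrightarrow> g m < g (m + h)"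
        by auto
      define h where "h = min (d / 2) (b - m)"
      have "0 < h" "h < d" "m + h \<in> {a..b}"
        using d(1) \<open>m < b\<close> \<open>a \<le> m\<close> by (auto simp: h_def min_def)
      with d(2)[of h] m(2)[of "m + h"] show False by simp
    qed
    with m(2)[of a] \<open>a \<le> b\<close> show ?thesis
      by (simp add: g_def algebra_simps)
  qed
  show ?thesis
  proof (rule field_le_epsilon)
    fix e :: real assume "0 < e"
    \<comment> \<open>The summand \<open>1\<close> avoids a division by zero for \<open>a = b\<close>.\<close>
    then have "f a \<le> f b + e / (b - a + 1) * (b - a)"
      using assms(1) by (intro tilted) auto
    moreover have "e / (b - a + 1) * (b - a) \<le> e"
      using \<open>0 < e\<close> assms(1) by (simp add: field_simps)
    ultimately show "f a \<le> f b + e" by linarith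
  qed
qed

context
  fixes S :: "'s set" and PP :: "'s \<Rightarrow> 'w measure" and X :: "real \<Rightarrow> 'w \<Rightarrow> 's" and K :: "real \<Rightarrow> 's \<Rightarrow> 's pmf"
    and L :: "('s \<Rightarrow> real) \<Rightarrow> 's \<Rightarrow> real"
  assumes S: "countable S" and markov: "jump_markov_process S PP X" and K: "transition_kernel S PP X K"
    and gen: "has_generator S PP X L"
begin

text \<open>
  The increment of \<open>t \<mapsto> K t x\<close> over a short time \<open>h\<close> is taken at the beginning of the path:
  \<open>K (t + h) x\<close> is \<open>K t\<close> averaged over \<open>K h x\<close>. The derivative is therefore the generator
  equation for the bounded function \<open>x \<mapsto> pmf (K t x) y\<close>, without any exchange of limits.
\<close>

lemma kernel_backward_equation:
  assumes "0 \<le> t" "x \<in> S"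
  shows "((\<lambda>t. pmf (K t x) y) has_real_derivative L (\<lambda>x. pmf (K t x) y) x) (at_right t)"
proof -
  let ?u = "\<lambda>t. pmf (K t x) y"
  have "bounded ((\<lambda>x. pmf (K t x) y) ` S)"
    by (auto simp: bounded_iff pmf_le_1 intro!: exI[of _ 1])
  with gen \<open>x \<in> S\<close> have "((\<lambda>h. ((\<integral>\<omega>. pmf (K t (X h \<omega>)) y \<partial>PP x) - ?u t) / h) \<longlongrightarrow> L (\<lambda>x. pmf (K t x) y) x) (at_right 0)"
    unfolding has_generator_def by blast
  moreover have "\<forall>\<^sub>F h in at_right 0. ((\<integral>\<omega>. pmf (K t (X h \<omega>)) y \<partial>PP x) - ?u t) / h = (?u (t + h) - ?u t) / h"
    using eventually_at_right_less[of 0]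
  proof eventually_elim
    case (elim h)
    then show ?case
      using expectation_kernel[OF S markov K, of h x "\<lambda>x'. pmf (K t x') y"]
        chapman_kolmogorov[OF S markov K, of h t x] assms
      by (simp add: pmf_bind add.commute)
  qed
  ultimately have "((\<lambda>h. (?u (t + h) - ?u t) / h) \<longlongrightarrow> L (\<lambda>x. pmf (K t x) y) x) (at_right 0)"
    by (simp add: tendsto_cong)
  then show ?thesis
    unfolding has_field_derivative_iff filterlim_at_right_to_0[of _ _ t] by (simp add: add.commute)
qed

text \<open>
  If the process is still at \<open>x\<close> after the time \<open>h\<close>, then the delay has had no effect on the law. The
  bound is uniform in \<open>s\<close> and therefore yields continuity from the left as well as from the right.
\<close>

lemma kernel_increment_le:
  assumes "0 \<le> s" "0 \<le> h" "x \<in> S"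
  shows "\<bar>pmf (K (s + h) x) y - pmf (K s x) y\<bar> \<le> 1 - pmf (K h x) x"
proof -
  let ?g = "\<lambda>x'. pmf (K s x') y"
  have int: "integrable (K h x) (f :: 's \<Rightarrow> real)" if "\<And>x. \<bar>f x\<bar> \<le> 1" for f
    using that by (intro measure_pmf.integrable_const_bound[where B = 1]) auto
  have diff: "\<bar>?g x' - ?g x\<bar> \<le> 1 - indicator {x} x'" for x'
    using pmf_nonneg[of "K s x'" y] pmf_nonneg[of "K s x" y] pmf_le_1[of "K s x'" y] pmf_le_1[of "K s x" y]
    by (cases "x' = x") (auto simp: abs_le_iff simp del: pmf_nonneg pmf_le_1)
  have "pmf (K (s + h) x) y - ?g x = measure_pmf.expectation (K h x) ?g - ?g x"
    using chapman_kolmogorov[OF S markov K, of h s x] assms by (simp add: pmf_bind add.commute)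
  also have "\<dots> = measure_pmf.expectation (K h x) (\<lambda>x'. ?g x' - ?g x)"
    by (subst Bochner_Integration.integral_diff) (auto intro: int simp: pmf_le_1 measure_pmf.prob_space)
  also have "\<bar>\<dots>\<bar> \<le> measure_pmf.expectation (K h x) (\<lambda>x'. \<bar>?g x' - ?g x\<bar>)"
    by (rule integral_abs_bound)
  also have "\<dots> \<le> measure_pmf.expectation (K h x) (\<lambda>x'. 1 - indicator {x} x')"
  proof (rule integral_mono)
    show "integrable (K h x) (\<lambda>x'. \<bar>?g x' - ?g x\<bar>)"
      by (rule int) (use diff in \<open>smt (verit, ccfv_threshold) indicator_pos_le\<close>)
    show "integrable (K h x) (\<lambda>x'. 1 - indicator {x} x' :: real)"
      by (rule int) (simp add: indicator_def)
  qed (rule diff)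
  also have "\<dots> = 1 - pmf (K h x) x"
    by (subst Bochner_Integration.integral_diff) (auto simp: measure_pmf.prob_space pmf.rep_eq intro!: int simp: indicator_def)
  finally show ?thesis .
qed

lemma holding_prob_tendsto_1:
  assumes "x \<in> S"
  shows "((\<lambda>h. 1 - pmf (K h x) x) \<longlongrightarrow> 0) (at_right 0)"
proof -
  have "((\<lambda>t. pmf (K t x) x) \<longlongrightarrow> pmf (K 0 x) x) (at_right 0)"
    using has_field_derivative_imp_has_derivative[OF kernel_backward_equation[of 0 x x]] assms
    by (auto dest: has_derivative_continuous simp: continuous_within)
  then have "((\<lambda>h. 1 - pmf (K h x) x) \<longlongrightarrow> 1 - 1) (at_right 0)"
    using kernel_0[OF S markov K assms] by (intro tendsto_intros) simp
  then show ?thesis by simp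
qed

lemma kernel_continuous:
  assumes "x \<in> S"
  shows "continuous_on {0..T} (\<lambda>t. pmf (K t x) y)"
proof -
  let ?u = "\<lambda>t. pmf (K t x) y"
  have "\<exists>d>0. \<forall>s\<in>{0..T}. dist s t < d \<longrightarrow> dist (?u s) (?u t) < e" if "0 \<le> t" "0 < e" for t e
  proof -
    obtain d where d: "0 < d" "\<And>h. 0 < h \<Longrightarrow> h < d \<Longrightarrow> 1 - pmf (K h x) x < e"
      using order_tendstoD(2)[OF holding_prob_tendsto_1[OF assms] \<open>0 < e\<close>]
      by (auto simp: eventually_at_right_field)
    have "dist (?u s) (?u t) < e" if "0 \<le> s" "dist s t < d" for s
    proof (cases s t rule: linorder_cases)
      case less
      then show ?thesis
        using kernel_increment_le[of s "t - s" x y] d(2)[of "t - s"] that assms by (auto simp: dist_real_def)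
    next
      case greater
      then show ?thesis
        using kernel_increment_le[of t "s - t" x y] d(2)[of "s - t"] that assms \<open>0 \<le> t\<close> by (auto simp: dist_real_def)
    qed (use \<open>0 < e\<close> in simp)
    with d(1) show ?thesis by auto
  qed
  then show ?thesis unfolding continuous_on_iff by auto
qed

lemma exp_uminus_mult_le_iff:
  fixes a u v :: real
  shows "exp (- a) * u \<le> v \<longleftrightarrow> u \<le> exp a * v"
  by (simp add: exp_minus field_simps)

text \<open>
  \<open>R\<close> bounds the total jump rate, \<open>level x\<close> counts the jumps that lead from \<open>x\<close> to \<open>z\<close>, and \<open>c\<close> is a
  lower bound for the rate of each of them. The asserted bound is \<open>exp (- R t)\<close> times the solution
  of \<open>\<psi>\<^sub>0 = 1\<close>, \<open>\<psi>\<^sub>k\<^sub>+\<^sub>1' = c \<psi>\<^sub>k\<close>, \<open>\<psi>\<^sub>k\<^sub>+\<^sub>1 0 = 0\<close>, and the backward equation shows that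
  \<open>exp (R t) pmf (K t x) z\<close> grows at least as fast as \<open>\<psi>\<^sub>k\<close> for a state \<open>x\<close> of level \<open>k\<close>.
\<close>

lemma kernel_lower_bound:
  fixes level :: "'s \<Rightarrow> nat"
  assumes "0 \<le> c"
    and level_0: "\<And>x. x \<in> S \<Longrightarrow> level x = 0 \<Longrightarrow> x = z"
    and exit: "\<And>x g. x \<in> S \<Longrightarrow> (\<And>y. g y \<in> {0..1}) \<Longrightarrow> - R * g x \<le> L g x"
    and descent: "\<And>x k. x \<in> S \<Longrightarrow> level x = Suc k \<Longrightarrow>
      \<exists>x'\<in>S. level x' = k \<and> (\<forall>g. (\<forall>y. g y \<in> {0..1}) \<longrightarrow> c * g x' - R * g x \<le> L g x)"
    and "x \<in> S" "0 \<le> t"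
  shows "exp (- R * t) * ((c * t) ^ level x / fact (level x)) \<le> pmf (K t x) z"
  using assms(5,6)
proof (induction "level x" arbitrary: x t)
  case 0
  let ?f = "\<lambda>t. exp (R * t) * pmf (K t x) z"
  have "?f 0 \<le> ?f t"
  proof (rule mono_if_right_derivative_nonneg[of 0 t ?f])
    fix s assume "0 \<le> s" "s < t"
    let ?D = "exp (R * s) * (L (\<lambda>x. pmf (K s x) z) x + R * pmf (K s x) z)"
    have "(?f has_real_derivative ?D) (at_right s)"
      using \<open>x \<in> S\<close> \<open>0 \<le> s\<close>
      by (auto intro!: derivative_eq_intros kernel_backward_equation simp: algebra_simps)
    moreover have "0 \<le> ?D"
      using exit[OF \<open>x \<in> S\<close>, of "\<lambda>x. pmf (K s x) z"] by (simp add: pmf_le_1)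
    ultimately show "\<exists>D\<ge>0. (?f has_real_derivative D) (at_right s)" by blast
  qed (use 0 kernel_continuous in \<open>auto intro!: continuous_intros\<close>)
  moreover have "x = z" using level_0 0 by simp
  ultimately have "1 \<le> exp (R * t) * pmf (K t x) z"
    using kernel_0[OF S markov K \<open>x \<in> S\<close>] by simp
  then show ?case
    unfolding \<open>0 = level x\<close>[symmetric] mult_minus_left exp_uminus_mult_le_iff by simp
next
  case (Suc k)
  obtain x' where x': "x' \<in> S" "level x' = k"
    and L: "\<And>g. (\<And>y. g y \<in> {0..1}) \<Longrightarrow> c * g x' - R * g x \<le> L g x"
    using descent[of x k] Suc.prems Suc.hyps(2) by metis
  let ?f = "\<lambda>t. exp (R * t) * pmf (K t x) z - (c * t) ^ Suc k / fact (Suc k)"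
  have "?f 0 \<le> ?f t"
  proof (rule mono_if_right_derivative_nonneg[of 0 t ?f])
    fix s assume "0 \<le> s" "s < t"
    let ?u = "\<lambda>x. pmf (K s x) z"
    let ?D = "exp (R * s) * (L ?u x + R * ?u x) - c * ((c * s) ^ k / fact k)"
    have "((\<lambda>t. (c * t) ^ Suc k / fact (Suc k)) has_real_derivative c * ((c * s) ^ k / fact k)) (at_right s)"
      by (rule derivative_eq_intros refl | simp)+
    moreover have "((\<lambda>t. exp (R * t) * pmf (K t x) z) has_real_derivative
        exp (R * s) * (L ?u x + R * ?u x)) (at_right s)"
      using Suc.prems \<open>0 \<le> s\<close>
      by (auto intro!: derivative_eq_intros kernel_backward_equation simp: algebra_simps)
    ultimately have "(?f has_real_derivative ?D) (at_right s)"
      by (intro DERIV_diff)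
    moreover have "0 \<le> ?D"
    proof -
      have "exp (- R * s) * ((c * s) ^ k / fact k) \<le> ?u x'"
        using Suc.hyps(1)[of x' s] x' \<open>0 \<le> s\<close> by simp
      then have "(c * s) ^ k / fact k \<le> exp (R * s) * ?u x'"
        unfolding mult_minus_left exp_uminus_mult_le_iff .
      then have "c * ((c * s) ^ k / fact k) \<le> exp (R * s) * (c * ?u x')"
        using mult_left_mono[OF _ \<open>0 \<le> c\<close>, of "(c * s) ^ k / fact k" "exp (R * s) * ?u x'"]
        by (simp add: mult.left_commute)
      also have "\<dots> \<le> exp (R * s) * (L ?u x + R * ?u x)"
        using L[of ?u] by (intro mult_left_mono) (auto simp: pmf_le_1)
      finally show ?thesis by simp
    qed
    ultimately show "\<exists>D\<ge>0. (?f has_real_derivative D) (at_right s)" by blast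
  qed (use Suc.prems kernel_continuous in \<open>auto intro!: continuous_intros\<close>)
  then have "(c * t) ^ Suc k / fact (Suc k) \<le> exp (R * t) * pmf (K t x) z"
    using pmf_nonneg[of "K 0 x" z] by (simp del: pmf_nonneg)
  then show ?case
    unfolding Suc.hyps(2)[symmetric] mult_minus_left exp_uminus_mult_le_iff .
qed

end

section \<open>Jump rates of the Fleming-Viot process\<close>

context
  fixes \<Lambda> :: "'a set" and zero :: 'a and q :: "'a \<Rightarrow> 'a \<Rightarrow> real" and M :: real and N :: nat
  assumes zero: "zero \<notin> \<Lambda>" and N: "2 \<le> N"
    and q_nonneg: "\<And>x y. x \<in> \<Lambda> \<Longrightarrow> y \<in> insert zero \<Lambda> - {x} \<Longrightarrow> 0 \<le> q x y"
    and q_bound: "\<And>x F. x \<in> \<Lambda> \<Longrightarrow> finite F \<Longrightarrow> F \<subseteq> insert zero \<Lambda> - {x} \<Longrightarrow> sum (q x) F \<le> M"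
begin

definition particle_rate :: "(nat \<Rightarrow> 'a) \<Rightarrow> nat \<Rightarrow> 'a \<Rightarrow> real" where
  "particle_rate \<xi> i y = q (\<xi> i) y + q (\<xi> i) zero * (occupation N \<xi> y / (real N - 1))"

lemma particle_rate_ge:
  assumes "\<xi> i \<in> \<Lambda>" "y \<in> \<Lambda> - {\<xi> i}"
  shows "0 \<le> particle_rate \<xi> i y" "q (\<xi> i) y \<le> particle_rate \<xi> i y"
proof -
  have "0 \<le> q (\<xi> i) zero * (occupation N \<xi> y / (real N - 1))"
    using q_nonneg[of "\<xi> i" zero] assms zero N
    by (intro mult_nonneg_nonneg divide_nonneg_nonneg) (auto simp: occupation_def intro!: sum_nonneg)
  with q_nonneg[of "\<xi> i" y] assms
  show "0 \<le> particle_rate \<xi> i y" "q (\<xi> i) y \<le> particle_rate \<xi> i y"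
    by (auto simp: particle_rate_def)
qed

text \<open>
  The moves of the particle itself contribute at most \<open>M\<close>. Its absorption has rate at most \<open>M\<close>, and the
  occupation numbers of distinct states add up to at most \<open>N\<close>, so that the weights of the target
  states add up to at most \<open>N / (N - 1) \<le> 2\<close>.
\<close>

lemma sum_particle_rate_le:
  assumes "\<xi> i \<in> \<Lambda>" "finite F" "F \<subseteq> \<Lambda> - {\<xi> i}"
  shows "sum (particle_rate \<xi> i) F \<le> 3 * M"
proof -
  have q0: "0 \<le> q (\<xi> i) zero" "q (\<xi> i) zero \<le> M"
    using q_nonneg[of "\<xi> i" zero] q_bound[of "\<xi> i" "{zero}"] assms(1) zero by auto
  have "(\<Sum>y\<in>F. occupation N \<xi> y) = (\<Sum>j=1..N. \<Sum>y\<in>F. of_bool (\<xi> j = y))"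
    unfolding occupation_def by (rule sum.swap)
  also have "\<dots> \<le> (\<Sum>j=1..N. 1)"
    using assms(2) by (intro sum_mono) (simp add: of_bool_def sum.delta')
  finally have "(\<Sum>y\<in>F. occupation N \<xi> y) / (real N - 1) \<le> real N / (real N - 1)"
    using N by (intro divide_right_mono) auto
  also have "\<dots> \<le> 2"
    using N by (simp add: field_simps)
  finally have occ: "(\<Sum>y\<in>F. occupation N \<xi> y) / (real N - 1) \<le> 2" .
  have "sum (particle_rate \<xi> i) F
      = sum (q (\<xi> i)) F + q (\<xi> i) zero * ((\<Sum>y\<in>F. occupation N \<xi> y) / (real N - 1))"
    by (simp add: particle_rate_def sum.distrib sum_distrib_left sum_divide_distrib)
  also have "\<dots> \<le> M + M * 2"
    using q_bound[of "\<xi> i" F] assms q0 occ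
    using N
    by (intro add_mono mult_mono) (auto simp: occupation_def intro!: sum_nonneg divide_nonneg_nonneg)
  finally show ?thesis by simp
qed

lemma particle_rate_summable:
  assumes "\<xi> i \<in> \<Lambda>"
  shows "particle_rate \<xi> i summable_on \<Lambda> - {\<xi> i}" "infsum (particle_rate \<xi> i) (\<Lambda> - {\<xi> i}) \<le> 3 * M"
proof -
  show summable: "particle_rate \<xi> i summable_on \<Lambda> - {\<xi> i}"
    using particle_rate_ge(1)[of \<xi> i, OF assms] sum_particle_rate_le[of \<xi> i, OF assms]
    by (intro nonneg_bdd_above_summable_on bdd_aboveI2) auto
  show "infsum (particle_rate \<xi> i) (\<Lambda> - {\<xi> i}) \<le> 3 * M"
    using sum_particle_rate_le[of \<xi> i, OF assms] by (intro infsum_le_finite_sums summable) auto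
qed

text \<open>
  The generator is split into the gain term, of which only finitely many jumps are kept, and the loss
  term, which is bounded by the total jump rate.
\<close>

lemma particle_generator_ge:
  fixes g :: "(nat \<Rightarrow> 'a) \<Rightarrow> real"
  assumes \<xi>: "\<xi> i \<in> \<Lambda>" and g: "\<And>\<zeta>. g \<zeta> \<in> {0..1}" and F: "finite F" "F \<subseteq> \<Lambda> - {\<xi> i}"
  shows "(\<Sum>y\<in>F. q (\<xi> i) y * g (\<xi>(i := y))) - 3 * M * g \<xi>
    \<le> (\<Sum>\<^sub>\<infinity>y\<in>\<Lambda> - {\<xi> i}. particle_rate \<xi> i y * (g (\<xi>(i := y)) - g \<xi>))"
proof -
  note r = particle_rate_summable[of \<xi> i, OF \<xi>]
  have g01: "0 \<le> g \<zeta>" "g \<zeta> \<le> 1" for \<zeta> using g[of \<zeta>] by auto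
  have gain: "(\<lambda>y. particle_rate \<xi> i y * g (\<xi>(i := y))) summable_on \<Lambda> - {\<xi> i}"
    using r(1) by (rule summable_on_comparison_test)
      (use particle_rate_ge(1)[of \<xi> i, OF \<xi>] g01 in \<open>auto intro: mult_left_le\<close>)
  have "(\<Sum>y\<in>F. q (\<xi> i) y * g (\<xi>(i := y))) \<le> (\<Sum>y\<in>F. particle_rate \<xi> i y * g (\<xi>(i := y)))"
    using F particle_rate_ge(2)[of \<xi> i, OF \<xi>] g01 by (intro sum_mono mult_right_mono) auto
  also have "\<dots> \<le> (\<Sum>\<^sub>\<infinity>y\<in>\<Lambda> - {\<xi> i}. particle_rate \<xi> i y * g (\<xi>(i := y)))"
    using F particle_rate_ge(1)[of \<xi> i, OF \<xi>] g01 by (intro finite_sum_le_infsum gain) auto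
  finally have "(\<Sum>y\<in>F. q (\<xi> i) y * g (\<xi>(i := y))) - 3 * M * g \<xi>
      \<le> (\<Sum>\<^sub>\<infinity>y\<in>\<Lambda> - {\<xi> i}. particle_rate \<xi> i y * g (\<xi>(i := y))) - infsum (particle_rate \<xi> i) (\<Lambda> - {\<xi> i}) * g \<xi>"
    using r(2) g01 by (intro diff_mono mult_right_mono) auto
  also have "\<dots> = (\<Sum>\<^sub>\<infinity>y\<in>\<Lambda> - {\<xi> i}. particle_rate \<xi> i y * g (\<xi>(i := y)) + particle_rate \<xi> i y * - g \<xi>)"
    using infsum_add[OF gain summable_on_cmult_left[OF r(1), of "- g \<xi>"]]
      infsum_cmult_left'[of "particle_rate \<xi> i" "- g \<xi>" "\<Lambda> - {\<xi> i}"] by simp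
  finally show ?thesis by (simp add: right_diff_distrib)
qed

lemma fv_generator_ge:
  fixes g :: "(nat \<Rightarrow> 'a) \<Rightarrow> real"
  assumes \<xi>: "\<xi> \<in> configurations N \<Lambda>" and g: "\<And>\<zeta>. g \<zeta> \<in> {0..1}"
  shows "- (3 * M * N) * g \<xi> \<le> fv_generator \<Lambda> zero q N g \<xi>"
    and "j \<in> {1..N} \<Longrightarrow> z \<in> \<Lambda> - {\<xi> j} \<Longrightarrow>
      q (\<xi> j) z * g (\<xi>(j := z)) - 3 * M * N * g \<xi> \<le> fv_generator \<Lambda> zero q N g \<xi>"
proof -
  have \<xi>_mem: "\<xi> i \<in> \<Lambda>" if "i \<in> {1..N}" for i
    using \<xi> that by (auto simp: configurations_def)
  have gen: "(\<Sum>i=1..N. (\<Sum>y\<in>F i. q (\<xi> i) y * g (\<xi>(i := y))) - 3 * M * g \<xi>) \<le> fv_generator \<Lambda> zero q N g \<xi>"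
    if "\<And>i. i \<in> {1..N} \<Longrightarrow> finite (F i)" "\<And>i. i \<in> {1..N} \<Longrightarrow> F i \<subseteq> \<Lambda> - {\<xi> i}" for F
    unfolding fv_generator_def particle_rate_def[symmetric]
    using that \<xi>_mem by (intro sum_mono particle_generator_ge g) auto
  from gen[of "\<lambda>_. {}"] show "- (3 * M * N) * g \<xi> \<le> fv_generator \<Lambda> zero q N g \<xi>"
    by (simp add: algebra_simps)
  assume j: "j \<in> {1..N}" "z \<in> \<Lambda> - {\<xi> j}"
  have "(\<Sum>i=1..N. \<Sum>y\<in>(if i = j then {z} else {}). q (\<xi> i) y * g (\<xi>(i := y)))
      = (\<Sum>i=1..N. if i = j then q (\<xi> j) z * g (\<xi>(j := z)) else 0)"
    by (rule sum.cong) auto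
  with gen[of "\<lambda>i. if i = j then {z} else {}"] j
  show "q (\<xi> j) z * g (\<xi>(j := z)) - 3 * M * N * g \<xi> \<le> fv_generator \<Lambda> zero q N g \<xi>"
    by (simp add: sum_subtractf algebra_simps)
qed

end

definition misplaced :: "nat \<Rightarrow> 'a \<Rightarrow> (nat \<Rightarrow> 'a) \<Rightarrow> nat" where
  "misplaced N z \<xi> = card {i \<in> {1..N}. \<xi> i \<noteq> z}"

lemma misplaced_le: "misplaced N z \<xi> \<le> N"
proof -
  have "card {i \<in> {1..N}. \<xi> i \<noteq> z} \<le> card {1..N}"
    by (rule card_mono) auto
  then show ?thesis by (simp add: misplaced_def)
qed

lemma misplaced_eq_0:
  assumes "\<xi> \<in> configurations N \<Lambda>" "misplaced N z \<xi> = 0"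
  shows "\<xi> = (\<lambda>i\<in>{1..N}. z)"
  using assms by (auto simp: configurations_def misplaced_def fun_eq_iff restrict_def PiE_def extensional_def)

lemma misplaced_Suc:
  assumes "misplaced N z \<xi> = Suc k"
  obtains j where "j \<in> {1..N}" "\<xi> j \<noteq> z" "misplaced N z (\<xi>(j := z)) = k"
proof -
  have "card {i \<in> {1..N}. \<xi> i \<noteq> z} \<noteq> 0"
    using assms by (simp add: misplaced_def)
  then have "{i \<in> {1..N}. \<xi> i \<noteq> z} \<noteq> {}" by (metis card.empty)
  then obtain j where j: "j \<in> {1..N}" "\<xi> j \<noteq> z" by auto
  have "{i \<in> {1..N}. (\<xi>(j := z)) i \<noteq> z} = {i \<in> {1..N}. \<xi> i \<noteq> z} - {j}"
    by auto
  then have "misplaced N z (\<xi>(j := z)) = k"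
    using assms j by (simp add: misplaced_def del: Diff_insert)
  with j show thesis by (rule that)
qed

text \<open>
  The truncation at \<open>1\<close> covers the infimum over the empty set, which is infinite, and makes \<open>c ^ k\<close>
  decreasing in \<open>k\<close>.
\<close>

lemma ergodicity_coeff_posE:
  assumes "0 < ergodicity_coeff \<Lambda> q"
  obtains z c where "z \<in> \<Lambda>" "0 < c" "c \<le> 1" "\<And>x. x \<in> \<Lambda> - {z} \<Longrightarrow> c \<le> q x z"
proof -
  have "\<exists>z\<in>\<Lambda>. (INF x\<in>\<Lambda> - {z}. ennreal (q x z)) \<noteq> 0"
  proof (rule ccontr)
    assume "\<not> ?thesis"
    then have "ergodicity_coeff \<Lambda> q = 0"
      unfolding ergodicity_coeff_def by (intro infsum_0) auto
    with assms show False by simp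
  qed
  then obtain z where z: "z \<in> \<Lambda>" "(INF x\<in>\<Lambda> - {z}. ennreal (q x z)) \<noteq> 0"
    by blast
  define c where "c = enn2real (min 1 (INF x\<in>\<Lambda> - {z}. ennreal (q x z)))"
  have c: "ennreal c = min 1 (INF x\<in>\<Lambda> - {z}. ennreal (q x z))"
    unfolding c_def by (subst ennreal_enn2real) (auto simp: min_less_iff_disj)
  have "ennreal 0 < ennreal c"
    unfolding c using z(2) by (simp add: zero_less_iff_neq_zero)
  then have "0 < c" by (simp add: ennreal_less_zero_iff)
  have "ennreal c \<le> ennreal 1" unfolding c by simp
  then have "c \<le> 1" by (subst (asm) ennreal_le_iff) auto
  have "c \<le> q x z" if "x \<in> \<Lambda> - {z}" for x
  proof -
    have "ennreal c \<le> ennreal (q x z)"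
      unfolding c using that by (intro min.coboundedI2 INF_lower)
    then show ?thesis using \<open>0 < c\<close> by (auto simp: ennreal_le_iff2)
  qed
  with z(1) \<open>0 < c\<close> \<open>c \<le> 1\<close> show thesis by (rule that)
qed

lemma max_exit_rate_finiteE:
  assumes "max_exit_rate \<Lambda> zero q < \<infinity>"
    and "\<And>x y. x \<in> \<Lambda> \<Longrightarrow> y \<in> insert zero \<Lambda> - {x} \<Longrightarrow> 0 \<le> q x y"
  obtains M where "\<And>x F. x \<in> \<Lambda> \<Longrightarrow> finite F \<Longrightarrow> F \<subseteq> insert zero \<Lambda> - {x} \<Longrightarrow> sum (q x) F \<le> M"
proof -
  have "sum (q x) F \<le> enn2real (max_exit_rate \<Lambda> zero q)"
    if x: "x \<in> \<Lambda>" and F: "finite F" "F \<subseteq> insert zero \<Lambda> - {x}" for x F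
  proof -
    have "ennreal (sum (q x) F) = infsum (\<lambda>y. ennreal (q x y)) F"
      using F x assms(2) by (subst infsum_finite) (auto intro!: sum_ennreal[symmetric])
    also have "\<dots> \<le> (\<Sum>\<^sub>\<infinity>y\<in>insert zero \<Lambda> - {x}. ennreal (q x y))"
      using F(2) by (intro infsum_mono_neutral nonneg_summable_on_complete) auto
    also have "\<dots> \<le> max_exit_rate \<Lambda> zero q"
      unfolding max_exit_rate_def using x by (rule SUP_upper)
    finally show ?thesis
      using assms(1) by (cases "max_exit_rate \<Lambda> zero q") (auto simp: ennreal_le_iff)
  qed
  then show thesis by (rule that)
qed

theorem theorem1p3:
  fixes \<Lambda> :: "'a set" and zero :: 'a and q :: "'a \<Rightarrow> 'a \<Rightarrow> real"
    and PZ :: "'a \<Rightarrow> 'w measure" and Z :: "real \<Rightarrow> 'w \<Rightarrow> 'a"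
    and N :: nat
    and PX :: "(nat \<Rightarrow> 'a) \<Rightarrow> 'v measure" and \<Xi> :: "real \<Rightarrow> 'v \<Rightarrow> nat \<Rightarrow> 'a"
  assumes "countable \<Lambda>" and "zero \<notin> \<Lambda>"
    and "jump_markov_process (insert zero \<Lambda>) PZ Z"
    and "has_rates (insert zero \<Lambda>) PZ Z q"
    and "\<And>x. x \<in> \<Lambda> \<Longrightarrow> q zero x = 0"
    and "max_exit_rate \<Lambda> zero q < \<infinity>"
    and "\<And>x y t. x \<in> \<Lambda> \<Longrightarrow> y \<in> \<Lambda> \<Longrightarrow> t > 0 \<Longrightarrow> trans_prob PZ Z t x y > 0"
    and "\<And>x. x \<in> insert zero \<Lambda> \<Longrightarrow> AE \<omega> in PZ x. \<exists>t\<ge>0. Z t \<omega> = zero"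
    and "ergodicity_coeff \<Lambda> q > 0"
    and "N \<ge> 2"
    and "fleming_viot_process \<Lambda> zero q N PX \<Xi>"
  shows "ergodic (configurations N \<Lambda>) PX \<Xi>"
proof -
  let ?S = "configurations N \<Lambda>" and ?L = "fv_generator \<Lambda> zero q N"
  have S: "countable ?S"
    unfolding configurations_def using assms(1) by (intro countable_PiE) auto
  have markov: "jump_markov_process ?S PX \<Xi>" and gen: "has_generator ?S PX \<Xi> ?L"
    using assms(11) by (auto simp: fleming_viot_process_def)
  have q_nonneg: "\<And>x y. x \<in> \<Lambda> \<Longrightarrow> y \<in> insert zero \<Lambda> - {x} \<Longrightarrow> 0 \<le> q x y"
    using assms(4) by (auto simp: has_rates_def)
  obtain M where M: "\<And>x F. x \<in> \<Lambda> \<Longrightarrow> finite F \<Longrightarrow> F \<subseteq> insert zero \<Lambda> - {x} \<Longrightarrow> sum (q x) F \<le> M"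
    using max_exit_rate_finiteE[OF assms(6) q_nonneg] by metis
  note gen_ge = fv_generator_ge[where q = q and zero = zero, OF assms(2,10) q_nonneg M]
  obtain z c where z: "z \<in> \<Lambda>" and c: "0 < c" "c \<le> 1" "\<And>x. x \<in> \<Lambda> - {z} \<Longrightarrow> c \<le> q x z"
    using ergodicity_coeff_posE[OF assms(9)] by metis
  define zs where "zs = (\<lambda>i\<in>{1..N}. z)"
  have zs: "zs \<in> ?S"
    using z by (auto simp: zs_def configurations_def)
  obtain K where K: "transition_kernel ?S PX \<Xi> K"
    using ex_transition_kernel[OF S markov zs] by metis
  \<comment> \<open>Each of the \<open>N\<close> particles has total jump rate at most \<open>3 * M\<close>.\<close>
  define R where "R = 3 * M * N"
  \<comment> \<open>This is the bound at time \<open>1\<close> for \<open>k = N\<close> misplaced particles; as \<open>c \<le> 1\<close>, it is the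
    smallest one.\<close>
  define \<delta> where "\<delta> = exp (- R) * (c ^ N / fact N)"
  have "\<delta> \<le> trans_prob PX \<Xi> 1 \<xi> zs" if \<xi>: "\<xi> \<in> ?S" for \<xi>
  proof -
    have "\<delta> \<le> exp (- R) * (c ^ misplaced N z \<xi> / fact (misplaced N z \<xi>))"
      unfolding \<delta>_def using c misplaced_le[of N z \<xi>]
      by (intro mult_left_mono frac_le power_decreasing fact_mono) auto
    also have "\<dots> \<le> pmf (K 1 \<xi>) zs"
    proof -
      have "exp (- R * 1) * ((c * 1) ^ misplaced N z \<xi> / fact (misplaced N z \<xi>)) \<le> pmf (K 1 \<xi>) zs"
      proof (rule kernel_lower_bound[OF S markov K gen])
        fix \<zeta> k assume \<zeta>: "\<zeta> \<in> ?S" "misplaced N z \<zeta> = Suc k"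
        obtain j where j: "j \<in> {1..N}" "\<zeta> j \<noteq> z" "misplaced N z (\<zeta>(j := z)) = k"
          using misplaced_Suc[OF \<zeta>(2)] by metis
        have \<zeta>j: "\<zeta> j \<in> \<Lambda>" and upd: "\<zeta>(j := z) \<in> ?S"
          using \<zeta>(1) j(1) z by (auto simp: configurations_def PiE_def extensional_def)
        have "c * g (\<zeta>(j := z)) - R * g \<zeta> \<le> ?L g \<zeta>" if g: "\<forall>y. g y \<in> {0..1}" for g
        proof -
          have "c * g (\<zeta>(j := z)) \<le> q (\<zeta> j) z * g (\<zeta>(j := z))"
            using c(3)[of "\<zeta> j"] \<zeta>j j(2) g by (intro mult_right_mono) auto
          moreover have "q (\<zeta> j) z * g (\<zeta>(j := z)) - R * g \<zeta> \<le> ?L g \<zeta>"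
            unfolding R_def using g j z by (intro gen_ge(2) \<zeta>(1)) auto
          ultimately show ?thesis by linarith
        qed
        with j(3) upd show "\<exists>x'\<in>?S. misplaced N z x' = k \<and>
            (\<forall>g. (\<forall>y. g y \<in> {0..1}) \<longrightarrow> c * g x' - R * g \<zeta> \<le> ?L g \<zeta>)"
          by blast
      next
        show "\<zeta> = zs" if "\<zeta> \<in> ?S" "misplaced N z \<zeta> = 0" for \<zeta>
          using misplaced_eq_0[OF that] by (simp add: zs_def)
        show "- R * g \<zeta> \<le> ?L g \<zeta>" if "\<zeta> \<in> ?S" "\<And>y. g y \<in> {0..1}" for \<zeta> g
          unfolding R_def by (rule gen_ge(1)) (use that in auto)
      qed (use c(1) \<xi> in auto)
      then show ?thesis by simp
    qed
    also have "\<dots> = trans_prob PX \<Xi> 1 \<xi> zs"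
      using trans_prob_eq_pmf[OF S markov K _ \<xi>] by simp
    finally show ?thesis .
  qed
  moreover have "0 < \<delta>" using c by (simp add: \<delta>_def)
  ultimately show ?thesis
    using doeblin_imp_ergodic[OF S markov zs] by blast
qed

end
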